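(* Let $X$ be an interval-transitive interval space. Then the following conditions are equivalent: (1) $X$ is interval-antisymmetric. (2) $X$ is stiff. (3) For each convex set $A\subseteq X$, the binary relation $\langle A,\cdot,\cdot\rangle$ is antisymmetric on $X\setminus A$. (4) The pair consisting of $X$ and the set of convex subsets of $X$ is an antiexchange space. (5) The pair consisting of $X$ and the set of convex subsets of $X$ is an antimatroid.
   Context: An interval space is a set $X$ with a ternary relation $\langle\cdot,\cdot,\cdot\rangle$ such that: for each $a\in X$, $\langle x,x,a\rangle$ and $\langle a,x,x\rangle$ hold for all $x\in X$; $\langle x,a,z\rangle\Rightarrow\langle z,a,x\rangle$; and $\langle x,y,x\rangle$ implies $y=x$. For $A\subseteq X$ and $b,c\in X$, $\langle A,b,c\rangle$ means there is $a\in A$ with $\langle a,b,c\rangle$. For $a,c\in X$, $[a,c]=\{x\in X:\langle a,x,c\rangle\}$; for $A,C\subseteq X$, $[A,C]=\{x: \exists a\in A,c\in C,\ \langle a,x,c\rangle\}$. A set $C\subseteq X$ is convex iff $[C,C]\subseteq C$. $X$ is interval-transitive iff for all $a,b\in X$ the relation $\langle[a,b],\cdot,\cdot\rangle$ is transitive on $X$. $X$ is interval-antisymmetric iff for all $a,b\in X$ the relation $\langle[a,b],\cdot,\cdot\rangle$ is antisymmetric on $X\setminus[a,b]$. $X$ is stiff iff for all $a,b,c,d\in X$, ($\langle a,b,c\rangle$ and $b\neq c$ and $\langle b,c,d\rangle$) implies $\langle a,b,d\rangle$. A closure space is a pair $(X,C)$ with $C$ a set of subsets of $X$ ("closed sets")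 such that $X\in C$ and $\bigcap D\in C$ for each nonempty $D\subseteq C$; $\mathrm{cl}(A)$ is the intersection of all closed supersets of $A$. For $A\subseteq X$, the $A$-entailment relation is $x\vdash_A y$ iff $y\in\mathrm{cl}(A\cup\{x\})$. $(X,C)$ is an antiexchange space iff for each closed $A$, $\vdash_A$ is antisymmetric on $X\setminus A$. $(X,C)$ is combinatorial iff $\bigcup D\in C$ for each chain $D\subseteq C$. An antimatroid is a combinatorial antiexchange space in which $\emptyset$ is closed. *)

theory Defs
  imports Main
begin

text \<open>
  The ternary relation \<open>\<langle>x,y,z\<rangle>\<close> is a predicate \<open>R x y z\<close> on the ambient type;
  only its values on the carrier \<open>X\<close> matter.
\<close>

locale interval_space =
  fixes X :: "'a set" and R :: "'a \<Rightarrow> 'a \<Rightarrow> 'a \<Rightarrow> bool"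
  assumes left_end: "a \<in> X \<Longrightarrow> x \<in> X \<Longrightarrow> R x x a"
    and right_end: "a \<in> X \<Longrightarrow> x \<in> X \<Longrightarrow> R a x x"
    and symmetric: "x \<in> X \<Longrightarrow> a \<in> X \<Longrightarrow> z \<in> X \<Longrightarrow> R x a z \<Longrightarrow> R z a x"
    and degenerate: "x \<in> X \<Longrightarrow> y \<in> X \<Longrightarrow> R x y x \<Longrightarrow> y = x"

text \<open>The binary relation \<open>\<langle>A,\<cdot>,\<cdot>\<rangle>\<close>.\<close>

definition set_rel :: "('a \<Rightarrow> 'a \<Rightarrow> 'a \<Rightarrow> bool) \<Rightarrow> 'a set \<Rightarrow> 'a \<Rightarrow> 'a \<Rightarrow> bool" where
  "set_rel R A b c \<longleftrightarrow> (\<exists>a\<in>A. R a b c)"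

definition interval :: "'a set \<Rightarrow> ('a \<Rightarrow> 'a \<Rightarrow> 'a \<Rightarrow> bool) \<Rightarrow> 'a \<Rightarrow> 'a \<Rightarrow> 'a set" where
  "interval X R a c = {x \<in> X. R a x c}"

definition set_interval :: "'a set \<Rightarrow> ('a \<Rightarrow> 'a \<Rightarrow> 'a \<Rightarrow> bool) \<Rightarrow> 'a set \<Rightarrow> 'a set \<Rightarrow> 'a set" where
  "set_interval X R A C = {x \<in> X. \<exists>a\<in>A. \<exists>c\<in>C. R a x c}"

definition interval_convex :: "'a set \<Rightarrow> ('a \<Rightarrow> 'a \<Rightarrow> 'a \<Rightarrow> bool) \<Rightarrow> 'a set \<Rightarrow> bool" where
  "interval_convex X R C \<longleftrightarrow> C \<subseteq> X \<and> set_interval X R C C \<subseteq> C"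

definition interval_transitive :: "'a set \<Rightarrow> ('a \<Rightarrow> 'a \<Rightarrow> 'a \<Rightarrow> bool) \<Rightarrow> bool" where
  "interval_transitive X R \<longleftrightarrow>
    (\<forall>a\<in>X. \<forall>b\<in>X. transp_on X (set_rel R (interval X R a b)))"

definition interval_antisymmetric :: "'a set \<Rightarrow> ('a \<Rightarrow> 'a \<Rightarrow> 'a \<Rightarrow> bool) \<Rightarrow> bool" where
  "interval_antisymmetric X R \<longleftrightarrow>
    (\<forall>a\<in>X. \<forall>b\<in>X. antisymp_on (X - interval X R a b) (set_rel R (interval X R a b)))"

definition stiff :: "'a set \<Rightarrow> ('a \<Rightarrow> 'a \<Rightarrow> 'a \<Rightarrow> bool) \<Rightarrow> bool" where
  "stiff X R \<longleftrightarrow>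
    (\<forall>a\<in>X. \<forall>b\<in>X. \<forall>c\<in>X. \<forall>d\<in>X. R a b c \<and> b \<noteq> c \<and> R b c d \<longrightarrow> R a b d)"

locale closure_space =
  fixes X :: "'a set" and C :: "'a set set"
  assumes closed_subset: "C \<subseteq> Pow X"
    and carrier_closed: "X \<in> C"
    and Inter_closed: "D \<subseteq> C \<Longrightarrow> D \<noteq> {} \<Longrightarrow> \<Inter>D \<in> C"

definition cl :: "'a set set \<Rightarrow> 'a set \<Rightarrow> 'a set" where
  "cl C A = \<Inter>{B \<in> C. A \<subseteq> B}"

definition entails :: "'a set set \<Rightarrow> 'a set \<Rightarrow> 'a \<Rightarrow> 'a \<Rightarrow> bool" where
  "entails C A x y \<longleftrightarrow> y \<in> cl C (A \<union> {x})"

locale antiexchange_space = closure_space +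
  assumes antiexchange: "A \<in> C \<Longrightarrow> antisymp_on (X - A) (entails C A)"

definition combinatorial :: "'a set set \<Rightarrow> bool" where
  "combinatorial C \<longleftrightarrow> (\<forall>D. subset.chain C D \<longrightarrow> \<Union>D \<in> C)"

locale antimatroid = antiexchange_space +
  assumes combinatorial: "combinatorial C"
    and empty_closed: "{} \<in> C"

end

theory Submission
  imports Defs
begin

text \<open>
  Interval transitivity makes intervals convex and makes \<open>{z. \<langle>A,z,x\<rangle>}\<close> convex for convex \<open>A\<close>.
  Hence for nonempty convex \<open>A\<close> the entailment \<open>x \<turnstile>\<^sub>A y\<close> is just \<open>\<langle>A,y,x\<rangle>\<close>, which identifies (3)
  with (4). Stiffness chains \<open>\<langle>a,x,y\<rangle>\<close> and \<open>\<langle>x,y,b\<rangle>\<close> into \<open>\<langle>a,x,b\<rangle>\<close>, so that \<open>x \<in> A\<close>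
  whenever \<open>a, b \<in> A\<close>; conversely, if stiffness fails at \<open>a, b, c, d\<close>, then \<open>b\<close> and \<open>c\<close>
  violate antisymmetry over \<open>[a,d]\<close>.
\<close>

lemma interval_convexD:
  assumes "interval_convex X R A" "a \<in> A" "b \<in> A" "x \<in> X" "R a x b"
  shows "x \<in> A"
  using assms unfolding interval_convex_def set_interval_def by blast

lemma interval_convexI:
  assumes "A \<subseteq> X" "\<And>a b x. a \<in> A \<Longrightarrow> b \<in> A \<Longrightarrow> x \<in> X \<Longrightarrow> R a x b \<Longrightarrow> x \<in> A"
  shows "interval_convex X R A"
  using assms unfolding interval_convex_def set_interval_def by blast

lemma interval_convex_subset: "interval_convex X R A \<Longrightarrow> A \<subseteq> X"
  by (simp add: interval_convex_def)

lemma interval_convex_empty: "interval_convex X R {}"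
  by (simp add: interval_convex_def set_interval_def)

lemma closure_space_interval_convex: "closure_space X {A. interval_convex X R A}"
proof
  show "{A. interval_convex X R A} \<subseteq> Pow X"
    by (auto dest: interval_convex_subset)
  show "X \<in> {A. interval_convex X R A}"
    by (simp add: interval_convexI)
next
  fix D assume D: "D \<subseteq> {A. interval_convex X R A}" "D \<noteq> {}"
  have "interval_convex X R (\<Inter>D)"
  proof (rule interval_convexI)
    show "\<Inter>D \<subseteq> X"
      using D by (auto dest: interval_convex_subset)
  next
    fix a b x assume "a \<in> \<Inter>D" "b \<in> \<Inter>D" "x \<in> X" "R a x b"
    then show "x \<in> \<Inter>D"
      using D by (blast intro: interval_convexD)
  qed
  then show "\<Inter>D \<in> {A. interval_convex X R A}" by simp
qed

text \<open>Convexity tests only two points at a time, and two points of the union of a chain lie in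
  a common member.\<close>

lemma combinatorial_interval_convex: "combinatorial {A. interval_convex X R A}"
  unfolding combinatorial_def
proof (intro allI impI)
  fix D assume D: "subset.chain {A. interval_convex X R A} D"
  then have conv: "interval_convex X R A" if "A \<in> D" for A
    using that by (auto simp: subset.chain_def)
  have "interval_convex X R (\<Union>D)"
  proof (rule interval_convexI)
    show "\<Union>D \<subseteq> X"
      using conv by (auto dest: interval_convex_subset)
  next
    fix a b x assume h: "a \<in> \<Union>D" "b \<in> \<Union>D" "x \<in> X" "R a x b"
    then obtain A B where AB: "A \<in> D" "a \<in> A" "B \<in> D" "b \<in> B" by blast
    then have "A \<subseteq> B \<or> B \<subseteq> A"
      using D by (auto simp: subset_chain_def)
    then show "x \<in> \<Union>D"
      using AB h conv interval_convexD[of X R] by (meson UnionI subsetD)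
  qed
  then show "\<Union>D \<in> {A. interval_convex X R A}" by simp
qed

lemma antiexchange_space_iff_antimatroid_interval_convex:
  "antiexchange_space X {A. interval_convex X R A} \<longleftrightarrow>
    antimatroid X {A. interval_convex X R A}"
  by (simp add: antimatroid_def antimatroid_axioms_def combinatorial_interval_convex
      interval_convex_empty)

locale interval_transitive_space = interval_space +
  assumes interval_transitive: "interval_transitive X R"
begin

lemma interval_trans:
  assumes "a \<in> X" "b \<in> X" "x \<in> X" "y \<in> X" "z \<in> X"
    and "u \<in> X" "R a u b" "R u x y"
    and "v \<in> X" "R a v b" "R v y z"
  obtains w where "w \<in> X" "R a w b" "R w x z"
proof -
  have "transp_on X (set_rel R (interval X R a b))"
    using interval_transitive assms by (auto simp: interval_transitive_def)
  moreover have "set_rel R (interval X R a b) x y" "set_rel R (interval X R a b) y z"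
    using assms by (auto simp: set_rel_def interval_def)
  ultimately have "set_rel R (interval X R a b) x z"
    using assms by (meson transp_onD)
  then show thesis
    using that by (auto simp: set_rel_def interval_def)
qed

text \<open>Interval transitivity over the degenerate interval from \<open>a\<close> to
  \<open>a\<close>, whose only point is \<open>a\<close>.\<close>

lemma point_trans:
  assumes "a \<in> X" "x \<in> X" "y \<in> X" "z \<in> X" "R a x y" "R a y z"
  shows "R a x z"
proof -
  obtain w where "w \<in> X" "R a w a" "R w x z"
    using interval_trans[of a a x y z a a] assms left_end by metis
  then show ?thesis
    using degenerate assms by metis
qed

lemma interval_convex_interval:
  assumes "a \<in> X" "b \<in> X"
  shows "interval_convex X R (interval X R a b)"
proof (rule interval_convexI)
  show "interval X R a b \<subseteq> X" by (auto simp: interval_def)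
next
  fix x z y assume "x \<in> interval X R a b" "z \<in> interval X R a b" and y: "y \<in> X" "R x y z"
  then have xz: "x \<in> X" "R a x b" "z \<in> X" "R a z b" by (auto simp: interval_def)
  \<comment> \<open>Chain \<open>y\<close>, \<open>z\<close>, \<open>b\<close> over the interval
    from \<open>a\<close> to \<open>b\<close>, with \<open>x\<close> and \<open>a\<close> as left
    witnesses. Seen from \<open>b\<close>, the point \<open>y\<close> then precedes \<open>w\<close>
    and \<open>w\<close> precedes \<open>a\<close>.\<close>
  obtain w where "w \<in> X" "R a w b" "R w y b"
    using interval_trans[of a b y z b x a] assms xz y left_end by metis
  then have "R b y a"
    using point_trans[of b y w a] symmetric assms y by blast
  then show "y \<in> interval X R a b"
    using symmetric assms y by (simp add: interval_def)
qed

text \<open>This set is the candidate for the convex hull of \<open>A\<close> and \<open>x\<close>.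
  Convexity of \<open>A\<close> serves to absorb the final witness \<open>v\<close>.\<close>

lemma interval_convex_cone:
  assumes A: "interval_convex X R A" and x: "x \<in> X"
  shows "interval_convex X R {y \<in> X. set_rel R A y x}"
proof (rule interval_convexI)
  fix y y' z
  assume "y \<in> {y \<in> X. set_rel R A y x}" "y' \<in> {y \<in> X. set_rel R A y x}"
    and z: "z \<in> X" "R y z y'"
  then obtain a a' where a: "a \<in> A" "a' \<in> A" and y: "y \<in> X" "y' \<in> X" "R a y x" "R a' y' x"
    by (auto simp: set_rel_def)
  have aX: "a \<in> X" "a' \<in> X"
    using a A interval_convex_subset by blast+
  \<comment> \<open>Chain \<open>z, y, a\<close> over \<open>[a',x]\<close>, then \<open>z, w, x\<close> over \<open>[a,a']\<close>.\<close>
  obtain w where w: "w \<in> X" "R a' w x" "R w z a"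
    using interval_trans[of a' x z y a y' x] aX x y z right_end symmetric by metis
  obtain v where v: "v \<in> X" "R a v a'" "R v z x"
    using interval_trans[of a a' z w x a a'] aX x z w left_end right_end symmetric by metis
  then have "v \<in> A"
    using A a interval_convexD by metis
  then show "z \<in> {y \<in> X. set_rel R A y x}"
    using v z by (auto simp: set_rel_def)
qed auto

lemma interval_convex_singleton: "x \<in> X \<Longrightarrow> interval_convex X R {x}"
  by (rule interval_convexI) (auto dest: degenerate)

lemma cl_insert_interval_convex:
  assumes A: "interval_convex X R A" "A \<noteq> {}" and x: "x \<in> X"
  shows "cl {A. interval_convex X R A} (A \<union> {x}) = {y \<in> X. set_rel R A y x}"
proof
  have "A \<union> {x} \<subseteq> {y \<in> X. set_rel R A y x}"
    using A x interval_convex_subset[OF A(1)] by (auto simp: set_rel_def intro: left_end right_end)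
  then show "cl {A. interval_convex X R A} (A \<union> {x}) \<subseteq> {y \<in> X. set_rel R A y x}"
    using interval_convex_cone[OF A(1) x] unfolding cl_def by blast
  show "{y \<in> X. set_rel R A y x} \<subseteq> cl {A. interval_convex X R A} (A \<union> {x})"
    unfolding cl_def set_rel_def by (blast intro: interval_convexD)
qed

lemma antisymp_on_entails_iff_set_rel:
  assumes A: "interval_convex X R A"
  shows "antisymp_on (X - A) (entails {A. interval_convex X R A} A) \<longleftrightarrow>
    antisymp_on (X - A) (set_rel R A)"
proof (cases "A = {}")
  \<comment> \<open>The hull formula fails here: the cone over the empty set is empty, but the hull
    of \<open>x\<close> is the singleton. Both relations are still antisymmetric, one being empty
    and the other contained in equality.\<close>
  case True
  have "y = x" if "x \<in> X" "entails {A. interval_convex X R A} {} x y" for x y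
    using that interval_convex_singleton[OF that(1)] by (auto simp: entails_def cl_def)
  then show ?thesis
    using True by (auto simp: antisymp_on_def set_rel_def)
next
  case False
  \<comment> \<open>The arguments are swapped, which is harmless because antisymmetry passes to the
    converse relation.\<close>
  then have "entails {A. interval_convex X R A} A x y \<longleftrightarrow> set_rel R A y x"
    if "x \<in> X" "y \<in> X" for x y
    using that cl_insert_interval_convex[OF A _ that(1)] unfolding entails_def by blast
  then show ?thesis
    by (auto simp: antisymp_on_def)
qed

lemma antiexchange_space_iff:
  "antiexchange_space X {A. interval_convex X R A} \<longleftrightarrow>
    (\<forall>A. interval_convex X R A \<longrightarrow> antisymp_on (X - A) (set_rel R A))"
  by (simp add: antiexchange_space_def antiexchange_space_axioms_def
      closure_space_interval_convex antisymp_on_entails_iff_set_rel)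

lemma stiff_if_interval_antisymmetric:
  assumes "interval_antisymmetric X R"
  shows "stiff X R"
  unfolding stiff_def
proof (intro ballI impI, elim conjE, rule ccontr)
  fix a b c d
  assume X: "a \<in> X" "b \<in> X" "c \<in> X" "d \<in> X"
    and h: "R a b c" "b \<noteq> c" "R b c d" "\<not> R a b d"
  \<comment> \<open>Otherwise \<open>R a b c\<close> and \<open>R a c d\<close> would chain to
    \<open>R a b d\<close>. So \<open>c\<close> as well as \<open>b\<close> lies outside the
    interval from \<open>a\<close> to \<open>d\<close>.\<close>
  have "\<not> R a c d"
    using point_trans[of a b c d] X h by blast
  then have "b \<in> X - interval X R a d" "c \<in> X - interval X R a d"
    using X h by (auto simp: interval_def)
  \<comment> \<open>The witness is the endpoint \<open>a\<close>; for the opposite direction it is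
    \<open>d\<close>, after reversing \<open>R b c d\<close>.\<close>
  moreover have "set_rel R (interval X R a d) b c"
    using X h left_end by (auto simp: set_rel_def interval_def)
  moreover have "set_rel R (interval X R a d) c b"
    using X h right_end symmetric[of b c d] by (auto simp: set_rel_def interval_def)
  ultimately have "b = c"
    using assms X unfolding interval_antisymmetric_def by (meson antisymp_onD)
  then show False using h by simp
qed

end

lemma (in interval_space) antisymp_on_set_rel_if_stiff:
  assumes "stiff X R" and A: "interval_convex X R A"
  shows "antisymp_on (X - A) (set_rel R A)"
proof (rule antisymp_onI, rule ccontr)
  fix x y assume X: "x \<in> X - A" "y \<in> X - A" and "x \<noteq> y"
    and "set_rel R A x y" "set_rel R A y x"
  then obtain a b where ab: "a \<in> A" "b \<in> A" "R a x y" "R b y x"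
    by (auto simp: set_rel_def)
  have "a \<in> X" "b \<in> X"
    using ab A interval_convex_subset by blast+
  then have "R a x b"
    using assms(1) X ab \<open>x \<noteq> y\<close> symmetric[of b y x] unfolding stiff_def by blast
  then show False
    using interval_convexD[OF A] ab X by blast
qed

theorem theorem3p5:
  fixes X :: "'a set" and R :: "'a \<Rightarrow> 'a \<Rightarrow> 'a \<Rightarrow> bool"
  assumes "interval_space X R"
    and "interval_transitive X R"
  shows "(interval_antisymmetric X R \<longleftrightarrow> stiff X R) \<and>
    (stiff X R \<longleftrightarrow>
      (\<forall>A. interval_convex X R A \<longrightarrow> antisymp_on (X - A) (set_rel R A))) \<and>
    ((\<forall>A. interval_convex X R A \<longrightarrow> antisymp_on (X - A) (set_rel R A)) \<longleftrightarrow>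
      antiexchange_space X {A. interval_convex X R A}) \<and>
    (antiexchange_space X {A. interval_convex X R A} \<longleftrightarrow>
      antimatroid X {A. interval_convex X R A})"
proof -
  interpret interval_transitive_space X R
    using assms by (simp add: interval_transitive_space_def interval_transitive_space_axioms_def)
  \<comment> \<open>Intervals are themselves convex, so this closes the cycle of implications
    through stiffness.\<close>
  have "interval_antisymmetric X R"
    if "\<forall>A. interval_convex X R A \<longrightarrow> antisymp_on (X - A) (set_rel R A)"
    using that interval_convex_interval by (simp add: interval_antisymmetric_def)
  then show ?thesis
    using stiff_if_interval_antisymmetric antisymp_on_set_rel_if_stiff antiexchange_space_iff
      antiexchange_space_iff_antimatroid_interval_convex by blast
qed

end
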